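(* Let $\theta$ be one of the $2\times 2$ real matrices in the list given in the context, and let $\Sigma_{G(\theta)}$ be a one-input linear control system on $G(\theta)$ with nilrank zero (i.e. its linear vector field is $\mathcal{X}=(A,\xi)$ with $A=0$) satisfying the LARC. Then: 1. if $\theta\neq\begin{pmatrix}\gamma&-1\\1&\gamma\end{pmatrix}$ for all $\gamma\neq 0$, then $\Sigma_{G(\theta)}$ admits an infinite number of control sets with empty interior; 2. if $\theta=\begin{pmatrix}\gamma&-1\\1&\gamma\end{pmatrix}$ for some $\gamma\neq 0$, then $\Sigma_{G(\theta)}$ is controllable.
   Context: **Groups.** $\theta$ is one of $\begin{pmatrix}1&1\\0&1\end{pmatrix}$; $\begin{pmatrix}1&0\\0&\gamma\end{pmatrix}$ with $|\gamma|\le 1$; $\begin{pmatrix}\gamma&-1\\1&\gamma\end{pmatrix}$ with $\gamma\in\mathbb{R}$. Put $\rho_t=e^{t\theta}$. $G(\theta)=\mathbb{R}\times_\rho\mathbb{R}^2$ is $\mathbb{R}\times\mathbb{R}^2$ with product $(t_1,v_1)(t_2,v_2)=(t_1+t_2,v_1+\rho_{t_1}v_2)$. Put $\Lambda_t^\theta w=\int_0^t e^{s\theta}w\,ds$. **Linear control systems on $G(\theta)$.** A linear vector field $\mathcal{X}=(A,\xi)$, with $\xi\in\mathbb{R}^2$ and $A\in\mathfrak{gl}(2,\mathbb{R})$, $A\theta=\theta A$, is $\mathcal{X}(t,v)=(0,Av+\Lambda_t^\theta\xi)$; a left-invariant vector field $Y=(\alpha,\eta)\in\mathbb{R}\times\mathbb{R}^2$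 is $Y(t,v)=(\alpha,\rho_t\eta)$. A one-input linear control system (LCS) $\Sigma_{G(\theta)}$ is $\dot g=\mathcal{X}(g)+uY(g)$, i.e. $\dot t=u\alpha$, $\dot v=Av+\Lambda_t^\theta\xi+u\rho_t\eta$, with $u\in\Omega=[u^-,u^+]$, $u^-<0<u^+$. The nilrank of $\Sigma_{G(\theta)}$ is the rank of $A$. **Control systems.** For a system $\dot x=f_0(x)+u f_1(x)$ on a manifold $M$, $\mathcal{U}$ is the set of piecewise constant functions $\mathbf{u}$ with values in $\Omega$, and $\phi(s,x,\mathbf{u})$ is the solution with $\phi(0,x,\mathbf{u})=x$ (defined for all $s\in\mathbb{R}$). $\mathcal{O}^+(x)=\{\phi(S,x,\mathbf{u}):S>0,\mathbf{u}\in\mathcal{U}\}$. The system satisfies the Lie algebra rank condition (LARC) if the smallest Lie algebra of vector fields containing $f_0,f_1$ spans $T_xM$ at every $x\in M$. (For $\Sigma_{G(\theta)}$: equivalently, $\alpha\ne0$ and $w=\alpha\xi+A\eta$ is nonzero and not a common eigenvector of $A$ and $\theta$.) A subset $D\subset M$ is a control set if (i) for every $x\in D$ there is $\mathbf{u}\in\mathcal{U}$ with $\phi(\mathbb{R}^+,x,\mathbf{u})\subset D$; (ii) $D\subset\overline{\mathcal{O}^+(x)}$ for every $x\in D$; (iii) $D$ is maximal with respect to (i) and (ii). The system is controllable if the whole space $M$ is a control set. *)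

theory Defs
  imports "HOL-Analysis.Analysis"
begin

section \<open>The groups \<open>G(\<theta>)\<close> and their vector fields\<close>

text \<open>
  The manifold \<open>\<real> \<times> \<real>\<^sup>2\<close> underlying \<open>G(\<theta>)\<close> is the type \<open>real \<times> (real^2)\<close>; the group structure enters
  only through \<open>\<rho>\<^sub>t = e\<^bsup>t\<theta>\<^esup>\<close>.  Matrices are listed by rows.
\<close>

abbreviation mat22 :: "real \<Rightarrow> real \<Rightarrow> real \<Rightarrow> real \<Rightarrow> real^2^2" where
  "mat22 a b c d \<equiv> vector [vector [a, b], vector [c, d]]"

definition spiral_matrix :: "real \<Rightarrow> real^2^2" where
  "spiral_matrix \<gamma> = mat22 \<gamma> (-1) 1 \<gamma>"

definition structure_matrices :: "(real^2^2) set" where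
  "structure_matrices =
     {mat22 1 1 0 1} \<union> {mat22 1 0 0 \<gamma> |\<gamma>. \<bar>\<gamma>\<bar> \<le> 1} \<union> range spiral_matrix"

text \<open>
  The exponential is spelled out as a power series, because multiplication in the type \<open>real^2^2\<close>
  is not the matrix product, so the generic \<open>exp\<close> does not apply.
\<close>

definition matrix_exp :: "real^'n^'n \<Rightarrow> real^'n^'n" where
  "matrix_exp B = (\<Sum>n. (((**) B ^^ n) (mat 1)) /\<^sub>R fact n)"

definition rho :: "real^2^2 \<Rightarrow> real \<Rightarrow> real^2^2" where
  "rho \<theta> t = matrix_exp (t *\<^sub>R \<theta>)"

text \<open>The interval integral is oriented, so this is also the intended value for negative \<open>t\<close>.\<close>

definition Lambda :: "real^2^2 \<Rightarrow> real \<Rightarrow> real^2 \<Rightarrow> real^2" where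
  "Lambda \<theta> t w = (LBINT s=ereal 0..ereal t. rho \<theta> s *v w)"

definition linear_vf :: "real^2^2 \<Rightarrow> real^2^2 \<Rightarrow> real^2 \<Rightarrow> real \<times> (real^2) \<Rightarrow> real \<times> (real^2)" where
  "linear_vf \<theta> A \<xi> = (\<lambda>(t, v). (0, A *v v + Lambda \<theta> t \<xi>))"

definition left_invariant_vf :: "real^2^2 \<Rightarrow> real \<Rightarrow> real^2 \<Rightarrow> real \<times> (real^2) \<Rightarrow> real \<times> (real^2)" where
  "left_invariant_vf \<theta> \<alpha> \<eta> = (\<lambda>(t, v). (\<alpha>, rho \<theta> t *v \<eta>))"


section \<open>Control systems \<open>x' = f\<^sub>0(x) + u f\<^sub>1(x)\<close>\<close>

text \<open>
  A piecewise constant function on \<open>\<real>\<close> may have infinitely many break points, but only finitely many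
  in each bounded interval; its values at the break points are arbitrary.
\<close>

definition piecewise_constant :: "(real \<Rightarrow> 'b) \<Rightarrow> bool" where
  "piecewise_constant u \<longleftrightarrow>
     (\<exists>S. (\<forall>a b. finite (S \<inter> {a..b})) \<and>
          (\<forall>a b. a \<le> b \<and> {a..b} \<inter> S = {} \<longrightarrow> u a = u b))"

definition controls :: "real set \<Rightarrow> (real \<Rightarrow> real) set" where
  "controls \<Omega> = {u. piecewise_constant u \<and> range u \<subseteq> \<Omega>}"

text \<open>
  \<open>is_solution f0 f1 u x \<phi>\<close> says that \<open>\<phi> = \<phi>(\<cdot>, x, u)\<close>.  A piecewise constant \<open>u\<close> is continuous
  exactly at the points around which it is constant; there the differential equation has to hold,
  and at the isolated remaining points the pieces are glued continuously.
\<close>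

definition is_solution ::
  "('a::real_normed_vector \<Rightarrow> 'a) \<Rightarrow> ('a \<Rightarrow> 'a) \<Rightarrow> (real \<Rightarrow> real) \<Rightarrow> 'a \<Rightarrow> (real \<Rightarrow> 'a) \<Rightarrow> bool" where
  "is_solution f0 f1 u x \<phi> \<longleftrightarrow>
     \<phi> 0 = x \<and> continuous_on UNIV \<phi> \<and>
     (\<forall>s. isCont u s \<longrightarrow> (\<phi> has_vector_derivative f0 (\<phi> s) + u s *\<^sub>R f1 (\<phi> s)) (at s))"

definition pos_orbit ::
  "('a::real_normed_vector \<Rightarrow> 'a) \<Rightarrow> ('a \<Rightarrow> 'a) \<Rightarrow> real set \<Rightarrow> 'a \<Rightarrow> 'a set" where
  "pos_orbit f0 f1 \<Omega> x =
     {\<phi> S |\<phi> S u. S > 0 \<and> u \<in> controls \<Omega> \<and> is_solution f0 f1 u x \<phi>}"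

definition pre_control_set ::
  "('a::real_normed_vector \<Rightarrow> 'a) \<Rightarrow> ('a \<Rightarrow> 'a) \<Rightarrow> real set \<Rightarrow> 'a set \<Rightarrow> bool" where
  "pre_control_set f0 f1 \<Omega> D \<longleftrightarrow>
     (\<forall>x\<in>D. \<exists>u\<in>controls \<Omega>. \<exists>\<phi>. is_solution f0 f1 u x \<phi> \<and> \<phi> ` {0..} \<subseteq> D) \<and>
     (\<forall>x\<in>D. D \<subseteq> closure (pos_orbit f0 f1 \<Omega> x))"

definition control_set ::
  "('a::real_normed_vector \<Rightarrow> 'a) \<Rightarrow> ('a \<Rightarrow> 'a) \<Rightarrow> real set \<Rightarrow> 'a set \<Rightarrow> bool" where
  "control_set f0 f1 \<Omega> D \<longleftrightarrow>
     pre_control_set f0 f1 \<Omega> D \<and>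
     (\<forall>D'. pre_control_set f0 f1 \<Omega> D' \<and> D \<subseteq> D' \<longrightarrow> D' = D)"

definition controllable ::
  "('a::real_normed_vector \<Rightarrow> 'a) \<Rightarrow> ('a \<Rightarrow> 'a) \<Rightarrow> real set \<Rightarrow> bool" where
  "controllable f0 f1 \<Omega> \<longleftrightarrow> control_set f0 f1 \<Omega> UNIV"


section \<open>The Lie algebra rank condition\<close>

definition lie_bracket ::
  "('a::real_normed_vector \<Rightarrow> 'a) \<Rightarrow> ('a \<Rightarrow> 'a) \<Rightarrow> 'a \<Rightarrow> 'a" where
  "lie_bracket X Y = (\<lambda>p. frechet_derivative Y (at p) (X p) - frechet_derivative X (at p) (Y p))"

text \<open>
  Meant for smooth generators only; then all members are smooth and \<^const>\<open>frechet_derivative\<close> is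
  always a genuine derivative.
\<close>

inductive_set generated_lie_algebra ::
  "('a::real_normed_vector \<Rightarrow> 'a) set \<Rightarrow> ('a \<Rightarrow> 'a) set"
  for F :: "('a \<Rightarrow> 'a) set" where
  generator: "X \<in> F \<Longrightarrow> X \<in> generated_lie_algebra F"
| zero: "(\<lambda>p. 0) \<in> generated_lie_algebra F"
| add: "X \<in> generated_lie_algebra F \<Longrightarrow> Y \<in> generated_lie_algebra F \<Longrightarrow>
    (\<lambda>p. X p + Y p) \<in> generated_lie_algebra F"
| scale: "X \<in> generated_lie_algebra F \<Longrightarrow> (\<lambda>p. c *\<^sub>R X p) \<in> generated_lie_algebra F"
| bracket: "X \<in> generated_lie_algebra F \<Longrightarrow> Y \<in> generated_lie_algebra F \<Longrightarrow>
    lie_bracket X Y \<in> generated_lie_algebra F"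

definition LARC :: "('a::real_normed_vector \<Rightarrow> 'a) \<Rightarrow> ('a \<Rightarrow> 'a) \<Rightarrow> bool" where
  "LARC f0 f1 \<longleftrightarrow> (\<forall>p. span {X p |X. X \<in> generated_lie_algebra {f0, f1}} = UNIV)"

end

theory Submission
  imports Defs
begin

text \<open>
  In nilrank zero the linear vector field is \<open>(0, \<Lambda>\<^sub>t \<xi>)\<close>, so both vector fields depend on \<open>t\<close> only:
  the input steers \<open>t\<close> freely forwards and backwards, and \<open>v\<close> merely integrates.  Up to the
  coordinate change \<open>p = v - \<Lambda>\<^sub>t \<eta> / \<alpha>\<close> the system reads \<open>t' = u \<alpha>\<close>, \<open>p' = \<Lambda>\<^sub>t \<xi>\<close>, and everything is
  decided by the curve \<open>t \<mapsto> \<Lambda>\<^sub>t \<xi>\<close> in the plane.  The rank condition says that \<open>\<alpha> \<noteq> 0\<close> and that no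
  proper \<open>\<theta>\<close>-invariant subspace contains \<open>\<xi>\<close>
  (\<open>LARC_imp_alpha_nonzero\<close>, \<open>LARC_imp_cyclic\<close>).

  If \<open>\<theta>\<close> is not a genuine spiral, this curve lies in a closed half plane whose boundary is its
  tangent at \<open>t = 0\<close>: there is \<open>l \<noteq> 0\<close> with \<open>l \<bullet> \<Lambda>\<^sub>t \<xi> \<ge> 0\<close> for all \<open>t\<close>, with equality only for a set of
  \<open>t\<close> without interior (\<open>exists_nonnegative_functional\<close>).  Hence \<open>l \<bullet> p\<close> cannot decrease along a
  solution.  It is therefore constant on every control set, and as one can stay in a control set
  forever, \<open>l \<bullet> \<Lambda>\<^sub>t \<xi>\<close> vanishes there; so its interior is empty
  (\<open>pre_control_set_monotone_function\<close>).  Every point with \<open>t = 0\<close> is an equilibrium for \<open>u = 0\<close> and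
  lies in a control set by Zorn's lemma, and different values of \<open>l \<bullet> p\<close> give different control sets
  (\<open>infinitely_many_control_sets\<close>).

  If \<open>\<theta>\<close> is a spiral with \<open>\<gamma> \<noteq> 0\<close>, then \<open>\<Lambda>\<^sub>t \<xi> = \<rho>\<^sub>t \<zeta> - \<zeta>\<close> with \<open>\<theta> \<zeta> = \<xi>\<close>, and this curve winds around the
  origin: three of its points already span the plane with positive coefficients
  (\<open>spiral_Lambda_positive_span\<close>).  Waiting with \<open>u = 0\<close> for a time \<open>\<tau>\<close> at position \<open>t\<close> adds \<open>\<tau> \<Lambda>\<^sub>t \<xi>\<close> to
  \<open>v\<close>, while the displacement picked up when travelling between two positions does not depend
  on \<open>v\<close>.  Travelling through the three positions with suitable waiting times thus joins any two
  points exactly (\<open>spiral_controllable\<close>).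
\<close>


section \<open>The one-parameter groups \<open>\<rho>\<close> and their integrals \<open>\<Lambda>\<close>\<close>

lemma vector_2_exhaust: obtains a b where "w = (vector [a, b] :: real^2)"
proof
  show "w = vector [w $ 1, w $ 2]" by (simp add: vec_eq_iff forall_2)
qed

lemma inner_vector_2: "(vector [a, b] :: real^2) \<bullet> vector [c, d] = a * c + b * d"
  by (simp add: inner_vec_def sum_2)

lemma matrix_sums:
  fixes f :: "nat \<Rightarrow> real^'n^'m"
  assumes "\<And>i j. (\<lambda>n. f n $ i $ j) sums (S $ i $ j)"
  shows "f sums S"
  using assms unfolding sums_def by (auto intro!: vec_tendstoI)

lemma matrix_exp_eqI:
  assumes "P 0 = mat 1" "\<And>n. P (Suc n) = B ** P n"
    and "\<And>i j. (\<lambda>n. P n $ i $ j / fact n) sums (S $ i $ j)"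
  shows "matrix_exp B = S"
proof -
  have P: "((**) B ^^ n) (mat 1) = P n" for n
    by (induction n) (simp_all add: assms)
  have "(\<lambda>n. P n /\<^sub>R fact n) sums S"
    by (rule matrix_sums) (use assms(3) in \<open>simp add: divide_inverse mult.commute\<close>)
  then show ?thesis
    unfolding matrix_exp_def P by (simp add: sums_iff)
qed

lemma mat22_mult: "mat22 a b c d ** mat22 a' b' c' d' =
    mat22 (a * a' + b * c') (a * b' + b * d') (c * a' + d * c') (c * b' + d * d')"
  by (simp add: vec_eq_iff forall_2 matrix_matrix_mult_def sum_2)

lemma mat22_mult_vec: "mat22 a b c d *v w = vector [a * w $ 1 + b * w $ 2, c * w $ 1 + d * w $ 2]"
  by (simp add: vec_eq_iff forall_2 matrix_vector_mult_def sum_2)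

lemma mat22_scale: "r *\<^sub>R mat22 a b c d = mat22 (r * a) (r * b) (r * c) (r * d)"
  by (simp add: vec_eq_iff forall_2)

lemma mat_1_eq_mat22: "mat 1 = mat22 1 0 0 1"
  by (simp add: vec_eq_iff forall_2 mat_def)

lemma exp_sums: "(\<lambda>n. (t::real) ^ n / fact n) sums exp t"
  using exp_converges[of t] by (simp add: divide_inverse mult.commute)

lemma mult_exp_sums: "(\<lambda>n. real n * t ^ n / fact n) sums (t * exp t)"
proof -
  have "(\<lambda>n. t * (t ^ n / fact n)) sums (t * exp t)"
    by (intro sums_mult exp_sums)
  moreover have "t * (t ^ n / fact n) = real (Suc n) * t ^ Suc n / fact (Suc n)" for n
    by (simp add: field_simps del: of_nat_Suc)
  ultimately have "(\<lambda>n. real (Suc n) * t ^ Suc n / fact (Suc n)) sums (t * exp t)"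
    by simp
  from this[THEN sums_Suc] show ?thesis by simp
qed

text \<open>
  The powers of each of the three matrices have closed forms, whose exponential series are
  summed entry by entry.
\<close>

lemma rho_shear: "rho (mat22 1 1 0 1) t = mat22 (exp t) (t * exp t) 0 (exp t)"
  unfolding rho_def
proof (rule matrix_exp_eqI)
  let ?P = "\<lambda>n. mat22 (t ^ n) (real n * t ^ n) 0 (t ^ n)"
  show "?P 0 = mat 1"
    by (simp add: mat_1_eq_mat22)
  show "?P (Suc n) = t *\<^sub>R mat22 1 1 0 1 ** ?P n" for n
    by (simp add: mat22_scale mat22_mult algebra_simps)
  show "(\<lambda>n. mat22 (t ^ n) (real n * t ^ n) 0 (t ^ n) $ i $ j / fact n) sums
      (mat22 (exp t) (t * exp t) 0 (exp t) $ i $ j)" for i j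
    using exhaust_2[of i] exhaust_2[of j] by (auto simp: exp_sums mult_exp_sums)
qed

lemma rho_diagonal: "rho (mat22 1 0 0 \<gamma>) t = mat22 (exp t) 0 0 (exp (\<gamma> * t))"
  unfolding rho_def
proof (rule matrix_exp_eqI)
  let ?P = "\<lambda>n. mat22 (t ^ n) 0 0 ((\<gamma> * t) ^ n)"
  show "?P 0 = mat 1"
    by (simp add: mat_1_eq_mat22)
  show "?P (Suc n) = t *\<^sub>R mat22 1 0 0 \<gamma> ** ?P n" for n
    by (simp add: mat22_scale mat22_mult algebra_simps)
  show "(\<lambda>n. mat22 (t ^ n) 0 0 ((\<gamma> * t) ^ n) $ i $ j / fact n) sums
      (mat22 (exp t) 0 0 (exp (\<gamma> * t)) $ i $ j)" for i j
    using exhaust_2[of i] exhaust_2[of j] by (auto simp: exp_sums)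
qed

text \<open>
  The spiral matrix is multiplication by \<open>\<gamma> + \<i>\<close>, so its powers and exponential are read off from
  the complex ones.
\<close>

lemma rho_spiral:
  "rho (spiral_matrix \<gamma>) t =
     mat22 (exp (\<gamma> * t) * cos t) (- exp (\<gamma> * t) * sin t) (exp (\<gamma> * t) * sin t) (exp (\<gamma> * t) * cos t)"
  unfolding rho_def spiral_matrix_def
proof (rule matrix_exp_eqI)
  let ?z = "Complex (\<gamma> * t) t"
  let ?P = "\<lambda>n. mat22 (Re (?z ^ n)) (- Im (?z ^ n)) (Im (?z ^ n)) (Re (?z ^ n))"
  show "?P 0 = mat 1"
    by (simp add: mat_1_eq_mat22)
  show "?P (Suc n) = t *\<^sub>R mat22 \<gamma> (-1) 1 \<gamma> ** ?P n" for n
    by (simp add: mat22_scale mat22_mult algebra_simps)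
  have z: "(\<lambda>n. ?z ^ n /\<^sub>R fact n) sums exp ?z"
    by (rule exp_converges)
  have re: "(\<lambda>n. Re (?z ^ n) / fact n) sums (exp (\<gamma> * t) * cos t)"
    using sums_Re[OF z] by (simp add: Re_exp divide_inverse mult.commute)
  have im: "(\<lambda>n. Im (?z ^ n) / fact n) sums (exp (\<gamma> * t) * sin t)"
    using sums_Im[OF z] by (simp add: Im_exp divide_inverse mult.commute)
  show "(\<lambda>n. mat22 (Re (?z ^ n)) (- Im (?z ^ n)) (Im (?z ^ n)) (Re (?z ^ n)) $ i $ j / fact n) sums
      (mat22 (exp (\<gamma> * t) * cos t) (- exp (\<gamma> * t) * sin t)
             (exp (\<gamma> * t) * sin t) (exp (\<gamma> * t) * cos t) $ i $ j)" for i j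
    using exhaust_2[of i] exhaust_2[of j] re im sums_minus[OF im] by auto
qed

lemma has_vector_derivative_vector2:
  fixes f g :: "real \<Rightarrow> real"
  assumes "(f has_real_derivative f') (at t)" "(g has_real_derivative g') (at t)"
  shows "((\<lambda>t. vector [f t, g t] :: real^2) has_vector_derivative vector [f', g']) (at t)"
proof -
  have e: "vector [a, b] = a *\<^sub>R axis 1 1 + b *\<^sub>R (axis 2 1 :: real^2)" for a b :: real
    by (simp add: vec_eq_iff forall_2 axis_def)
  show ?thesis
    unfolding e by (auto intro!: derivative_eq_intros assms)
qed

lemma rho_vec_derivative:
  assumes "\<theta> \<in> structure_matrices"
  shows "((\<lambda>t. rho \<theta> t *v w) has_vector_derivative rho \<theta> t *v (\<theta> *v w)) (at t)"
proof -
  from assms consider "\<theta> = mat22 1 1 0 1" | \<gamma> where "\<theta> = mat22 1 0 0 \<gamma>" | \<gamma> where "\<theta> = spiral_matrix \<gamma>"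
    unfolding structure_matrices_def by auto
  then show ?thesis
  proof cases
    case 1
    show ?thesis
      unfolding 1 rho_shear mat22_mult_vec
      by (rule has_vector_derivative_eq_rhs, rule has_vector_derivative_vector2)
         (auto intro!: derivative_eq_intros refl simp: vec_eq_iff forall_2 algebra_simps)
  next
    case 2
    show ?thesis
      unfolding 2 rho_diagonal mat22_mult_vec
      by (rule has_vector_derivative_eq_rhs, rule has_vector_derivative_vector2)
         (auto intro!: derivative_eq_intros refl simp: vec_eq_iff forall_2 algebra_simps)
  next
    case 3
    show ?thesis
      unfolding 3 rho_spiral
      unfolding spiral_matrix_def mat22_mult_vec
      by (rule has_vector_derivative_eq_rhs, rule has_vector_derivative_vector2)
         (auto intro!: derivative_eq_intros refl simp: vec_eq_iff forall_2 algebra_simps)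
  qed
qed

lemma rho_0:
  assumes "\<theta> \<in> structure_matrices"
  shows "rho \<theta> 0 *v w = w"
  using assms unfolding structure_matrices_def
  by (auto simp: rho_shear rho_diagonal rho_spiral mat22_mult_vec) (simp_all add: vec_eq_iff forall_2)

lemma interval_integral_vector_derivative:
  fixes h :: "real \<Rightarrow> 'a::euclidean_space"
  assumes "continuous_on UNIV h"
  shows "((\<lambda>t. LBINT s=ereal 0..ereal t. h s) has_vector_derivative h t) (at t)"
proof -
  let ?a = "- \<bar>t\<bar> - 1" and ?b = "\<bar>t\<bar> + 1"
  have "((\<lambda>t. LBINT s=ereal 0..ereal t. h s) has_vector_derivative h t) (at t within {?a..?b})"
    by (rule interval_integral_FTC2) (auto intro: continuous_on_subset[OF assms])
  then have "((\<lambda>t. LBINT s=ereal 0..ereal t. h s) has_vector_derivative h t) (at t within {?a<..<?b})"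
    by (rule has_vector_derivative_within_subset) auto
  then show ?thesis
    by (subst (asm) has_vector_derivative_within_open) auto
qed

lemma Lambda_vector_derivative:
  assumes "\<theta> \<in> structure_matrices"
  shows "((\<lambda>t. Lambda \<theta> t w) has_vector_derivative rho \<theta> t *v w) (at t)"
  unfolding Lambda_def
  by (intro interval_integral_vector_derivative continuous_at_imp_continuous_on ballI)
     (rule has_vector_derivative_continuous[OF rho_vec_derivative[OF assms]])

lemma Lambda_0 [simp]: "Lambda \<theta> 0 w = 0"
  by (simp add: Lambda_def interval_lebesgue_integral_def set_lebesgue_integral_def)

lemma continuous_on_Lambda:
  assumes "\<theta> \<in> structure_matrices"
  shows "continuous_on UNIV (\<lambda>t. Lambda \<theta> t w)"
  by (intro continuous_at_imp_continuous_on ballI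
        has_vector_derivative_continuous[OF Lambda_vector_derivative[OF assms]])


section \<open>The rank condition in nilrank zero\<close>

lemma linear_vf_nilrank_zero: "linear_vf \<theta> 0 \<xi> = (\<lambda>p. (0, Lambda \<theta> (fst p) \<xi>))"
  by (auto simp: linear_vf_def)

lemma left_invariant_vf_eq: "left_invariant_vf \<theta> \<alpha> \<eta> = (\<lambda>p. (\<alpha>, rho \<theta> (fst p) *v \<eta>))"
  by (auto simp: left_invariant_vf_def)

lemma field_of_t_derivative:
  fixes h :: "real \<Rightarrow> real^2"
  assumes "(h has_vector_derivative h') (at (fst p))"
  shows "((\<lambda>p. (k::real, h (fst p))) has_derivative (\<lambda>q. (0, fst q *\<^sub>R h'))) (at (p :: real \<times> (real^2)))"
proof -
  have "((\<lambda>q. h (fst q)) has_derivative (\<lambda>q. fst q *\<^sub>R h')) (at p)"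
    using has_derivative_compose[OF has_derivative_fst[OF has_derivative_ident] assms[unfolded has_vector_derivative_def]]
    by simp
  then show ?thesis
    by (rule has_derivative_Pair[OF has_derivative_const])
qed

text \<open>
  A finite-dimensional space of vector fields that contains both generators and is closed under
  brackets whenever \<open>U\<close> is \<open>\<theta>\<close>-invariant and contains \<open>\<xi>\<close>.  The coefficient \<open>c\<close> occurs twice
  because \<open>\<alpha>\<close> and \<open>\<eta>\<close> only enter together, through the left-invariant field.
\<close>

definition nilrank_zero_fields :: "real^2^2 \<Rightarrow> real \<Rightarrow> real^2 \<Rightarrow> real^2 \<Rightarrow> (real^2) set \<Rightarrow> (real \<times> (real^2) \<Rightarrow> real \<times> (real^2)) set" where
  "nilrank_zero_fields \<theta> \<alpha> \<xi> \<eta> U =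
    {\<lambda>p. (c * \<alpha>, a *\<^sub>R Lambda \<theta> (fst p) \<xi> + c *\<^sub>R (rho \<theta> (fst p) *v \<eta>) + rho \<theta> (fst p) *v u) | a c u. u \<in> U}"

text \<open>
  As the fields depend on \<open>t\<close> only, the bracket of \<open>(c \<alpha>, h)\<close> and \<open>(d \<alpha>, k)\<close> is \<open>(0, \<alpha> (c k' - d h'))\<close>
  with derivatives in \<open>t\<close>.  Differentiation turns \<open>\<Lambda>\<^sub>t \<xi>\<close> into \<open>\<rho>\<^sub>t \<xi>\<close> and \<open>\<rho>\<^sub>t w\<close> into \<open>\<rho>\<^sub>t \<theta> w\<close>, and the
  two \<open>\<eta>\<close>-terms cancel; what remains is \<open>\<rho>\<^sub>t w\<close> with \<open>w \<in> U\<close>.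
\<close>

lemma generated_lie_algebra_subset_nilrank_zero_fields:
  assumes \<theta>: "\<theta> \<in> structure_matrices"
    and U: "subspace U" "\<xi> \<in> U" "\<And>u. u \<in> U \<Longrightarrow> \<theta> *v u \<in> U"
  shows "generated_lie_algebra {linear_vf \<theta> 0 \<xi>, left_invariant_vf \<theta> \<alpha> \<eta>} \<subseteq> nilrank_zero_fields \<theta> \<alpha> \<xi> \<eta> U"
proof
  fix X assume "X \<in> generated_lie_algebra {linear_vf \<theta> 0 \<xi>, left_invariant_vf \<theta> \<alpha> \<eta>}"
  then show "X \<in> nilrank_zero_fields \<theta> \<alpha> \<xi> \<eta> U"
  proof induction
    case (generator X)
    then consider "X = linear_vf \<theta> 0 \<xi>" | "X = left_invariant_vf \<theta> \<alpha> \<eta>" by blast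
    then show ?case
    proof cases
      case 1
      show ?thesis unfolding nilrank_zero_fields_def 1 mem_Collect_eq
        by (intro exI[of _ 1] exI[of _ 0]) (auto simp: linear_vf_def subspace_0[OF U(1)])
    next
      case 2
      show ?thesis unfolding nilrank_zero_fields_def 2 mem_Collect_eq
        by (rule exI[of _ 0], rule exI[of _ 1], rule exI[of _ 0])
           (auto simp: left_invariant_vf_def subspace_0[OF U(1)])
    qed
  next
    case zero
    show ?case unfolding nilrank_zero_fields_def mem_Collect_eq
      by (rule exI[of _ 0], rule exI[of _ 0], rule exI[of _ 0])
         (auto simp: subspace_0[OF U(1)] zero_prod_def)
  next
    case (add X Y)
    from add.IH(1) obtain a c u where X: "u \<in> U"
      "X = (\<lambda>p. (c * \<alpha>, a *\<^sub>R Lambda \<theta> (fst p) \<xi> + c *\<^sub>R (rho \<theta> (fst p) *v \<eta>) + rho \<theta> (fst p) *v u))"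
      unfolding nilrank_zero_fields_def by blast
    from add.IH(2) obtain a' c' u' where Y: "u' \<in> U"
      "Y = (\<lambda>p. (c' * \<alpha>, a' *\<^sub>R Lambda \<theta> (fst p) \<xi> + c' *\<^sub>R (rho \<theta> (fst p) *v \<eta>) + rho \<theta> (fst p) *v u'))"
      unfolding nilrank_zero_fields_def by blast
    show ?case unfolding nilrank_zero_fields_def mem_Collect_eq X Y
      by (rule exI[of _ "a + a'"], rule exI[of _ "c + c'"], rule exI[of _ "u + u'"])
         (auto simp: subspace_add[OF U(1)] X Y algebra_simps matrix_vector_right_distrib)
  next
    case (scale X r)
    from scale.IH obtain a c u where X: "u \<in> U"
      "X = (\<lambda>p. (c * \<alpha>, a *\<^sub>R Lambda \<theta> (fst p) \<xi> + c *\<^sub>R (rho \<theta> (fst p) *v \<eta>) + rho \<theta> (fst p) *v u))"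
      unfolding nilrank_zero_fields_def by blast
    show ?case unfolding nilrank_zero_fields_def mem_Collect_eq X
      by (rule exI[of _ "r * a"], rule exI[of _ "r * c"], rule exI[of _ "r *\<^sub>R u"])
         (auto simp: subspace_scale[OF U(1)] X algebra_simps matrix_vector_mult_scaleR)
  next
    case (bracket X Y)
    from bracket.IH(1) obtain a c u where X: "u \<in> U"
      "X = (\<lambda>p. (c * \<alpha>, a *\<^sub>R Lambda \<theta> (fst p) \<xi> + c *\<^sub>R (rho \<theta> (fst p) *v \<eta>) + rho \<theta> (fst p) *v u))"
      unfolding nilrank_zero_fields_def by blast
    from bracket.IH(2) obtain a' c' u' where Y: "u' \<in> U"
      "Y = (\<lambda>p. (c' * \<alpha>, a' *\<^sub>R Lambda \<theta> (fst p) \<xi> + c' *\<^sub>R (rho \<theta> (fst p) *v \<eta>) + rho \<theta> (fst p) *v u'))"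
      unfolding nilrank_zero_fields_def by blast
    have D: "frechet_derivative (\<lambda>p. (c * \<alpha>, a *\<^sub>R Lambda \<theta> (fst p) \<xi> + c *\<^sub>R (rho \<theta> (fst p) *v \<eta>) + rho \<theta> (fst p) *v u)) (at p)
      = (\<lambda>q. (0, fst q *\<^sub>R (rho \<theta> (fst p) *v (a *\<^sub>R \<xi> + c *\<^sub>R (\<theta> *v \<eta>) + \<theta> *v u))))" for a c u and p :: "real \<times> (real^2)"
      by (rule frechet_derivative_at[symmetric], rule field_of_t_derivative)
         (auto intro!: derivative_eq_intros rho_vec_derivative[OF \<theta>] Lambda_vector_derivative[OF \<theta>]
            simp: matrix_vector_right_distrib matrix_vector_mult_scaleR)
    define w where "w = (\<alpha> * (c * a' - c' * a)) *\<^sub>R \<xi> + \<theta> *v ((\<alpha> * c) *\<^sub>R u' - (\<alpha> * c') *\<^sub>R u)"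
    have "w \<in> U"
      unfolding w_def by (intro subspace_add[OF U(1)] subspace_scale[OF U(1)] subspace_diff[OF U(1)] U X Y)
    moreover have "lie_bracket X Y = (\<lambda>p. (0, rho \<theta> (fst p) *v w))"
      unfolding lie_bracket_def X(2) Y(2) D w_def
      by (simp add: fun_eq_iff matrix_vector_right_distrib matrix_vector_mult_diff_distrib matrix_vector_mult_scaleR algebra_simps)
    ultimately show ?case unfolding nilrank_zero_fields_def mem_Collect_eq
      by (intro exI[of _ 0] exI[of _ w]) auto
  qed
qed

text \<open>
  At the identity \<open>\<Lambda>\<close> vanishes and \<open>\<rho>\<close> is trivial, so there the Lie algebra takes its values in
  the subspace formed by the vectors \<open>(c \<alpha>, c \<eta> + u)\<close> with \<open>u \<in> U\<close>; the rank condition makes this everything.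
\<close>

lemma LARC_imp_tangent_vector_form:
  assumes \<theta>: "\<theta> \<in> structure_matrices"
    and L: "LARC (linear_vf \<theta> 0 \<xi>) (left_invariant_vf \<theta> \<alpha> \<eta>)"
    and U: "subspace U" "\<xi> \<in> U" "\<And>u. u \<in> U \<Longrightarrow> \<theta> *v u \<in> U"
  shows "\<exists>c u. u \<in> U \<and> q = (c * \<alpha>, c *\<^sub>R \<eta> + u)"
proof -
  let ?V = "{(c * \<alpha>, c *\<^sub>R \<eta> + u) |c u. u \<in> U}"
  have "subspace ?V"
    unfolding subspace_def
  proof (intro conjI ballI allI)
    show "0 \<in> ?V"
      using subspace_0[OF U(1)] by (auto simp: zero_prod_def intro!: exI[of _ 0])
    show "x + y \<in> ?V" if x: "x \<in> ?V" and y: "y \<in> ?V" for x y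
    proof -
      from x y obtain c u d v where "x = (c * \<alpha>, c *\<^sub>R \<eta> + u)" "y = (d * \<alpha>, d *\<^sub>R \<eta> + v)" "u \<in> U" "v \<in> U"
        by blast
      then show ?thesis
        by (auto intro!: exI[of _ "c + d"] exI[of _ "u + v"] simp: algebra_simps subspace_add[OF U(1)])
    qed
    show "r *\<^sub>R x \<in> ?V" if x: "x \<in> ?V" for r x
    proof -
      from x obtain c u where "x = (c * \<alpha>, c *\<^sub>R \<eta> + u)" "u \<in> U"
        by blast
      then show ?thesis
        by (auto intro!: exI[of _ "r * c"] exI[of _ "r *\<^sub>R u"] simp: algebra_simps subspace_scale[OF U(1)])
    qed
  qed
  moreover have "{X 0 |X. X \<in> generated_lie_algebra {linear_vf \<theta> 0 \<xi>, left_invariant_vf \<theta> \<alpha> \<eta>}} \<subseteq> ?V"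
    using generated_lie_algebra_subset_nilrank_zero_fields[OF \<theta> U, of \<alpha> \<eta>]
    by (force simp: nilrank_zero_fields_def rho_0[OF \<theta>])
  ultimately have "span {X 0 |X. X \<in> generated_lie_algebra {linear_vf \<theta> 0 \<xi>, left_invariant_vf \<theta> \<alpha> \<eta>}} \<subseteq> ?V"
    by (intro span_minimal)
  then have "q \<in> ?V"
    using L unfolding LARC_def by blast
  then show ?thesis by blast
qed

lemma LARC_imp_alpha_nonzero:
  assumes "\<theta> \<in> structure_matrices" "LARC (linear_vf \<theta> 0 \<xi>) (left_invariant_vf \<theta> \<alpha> \<eta>)"
  shows "\<alpha> \<noteq> 0"
  using LARC_imp_tangent_vector_form[OF assms, of UNIV "(1, 0)"] by (auto simp: subspace_UNIV)

text \<open>A vector \<open>(0, m)\<close> has the form above only with \<open>c = 0\<close>, which leaves \<open>m \<in> U\<close>.\<close>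

lemma LARC_imp_cyclic:
  assumes \<theta>: "\<theta> \<in> structure_matrices"
    and L: "LARC (linear_vf \<theta> 0 \<xi>) (left_invariant_vf \<theta> \<alpha> \<eta>)"
    and U: "subspace U" "\<xi> \<in> U" "\<And>u. u \<in> U \<Longrightarrow> \<theta> *v u \<in> U"
  shows "U = UNIV"
  using LARC_imp_tangent_vector_form[OF \<theta> L U, of "(0, _)"] LARC_imp_alpha_nonzero[OF \<theta> L] by fastforce

lemma cyclic_vector_nonzero:
  fixes \<theta> :: "real^2^2"
  assumes "\<And>U. subspace U \<Longrightarrow> \<xi> \<in> U \<Longrightarrow> (\<And>u. u \<in> U \<Longrightarrow> \<theta> *v u \<in> U) \<Longrightarrow> U = UNIV"
  shows "\<xi> \<noteq> 0"
proof
  assume "\<xi> = 0"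
  then have "{0 :: real^2} = UNIV" by (intro assms) (auto simp: subspace_0)
  then have "(vector [1, 0] :: real^2) \<in> {0}" by blast
  then show False by (simp add: vec_eq_iff forall_2)
qed


section \<open>Orbits and control sets of general systems\<close>

text \<open>Local finiteness of the break points isolates every other point from them.\<close>

lemma piecewise_constant_isCont:
  assumes S: "\<And>a b. finite (S \<inter> {a..b})"
    and u: "\<And>a b. a \<le> b \<Longrightarrow> {a..b} \<inter> S = {} \<Longrightarrow> u a = u b"
    and s: "s \<notin> S"
  shows "isCont u (s::real)"
proof -
  have "finite (S \<inter> {s-1..s+1})" by (rule S)
  then have "closed (S \<inter> {s-1..s+1})" by (rule finite_imp_closed)
  then have "open ({s-1<..<s+1} - S \<inter> {s-1..s+1})" by (intro open_Diff) auto
  then obtain e where e: "e > 0" "ball s e \<subseteq> {s-1<..<s+1} - S \<inter> {s-1..s+1}"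
    using s openE[of "{s-1<..<s+1} - S \<inter> {s-1..s+1}" s] by auto
  have eq: "u r = u s" if "r \<in> ball s e" for r
  proof -
    have "{min r s..max r s} \<subseteq> ball s e"
      using that by (auto simp: dist_real_def)
    then have "{min r s..max r s} \<inter> S = {}"
      using e(2) by force
    then have "u (min r s) = u (max r s)" by (intro u) auto
    then show ?thesis by (cases "r \<le> s") auto
  qed
  have "eventually (\<lambda>r. r \<in> ball s e) (nhds s)"
    using e(1) by (intro eventually_nhds_in_open) auto
  then have "eventually (\<lambda>r. u r = u s) (nhds s)"
    by (rule eventually_mono) (rule eq)
  then have "isCont u s \<longleftrightarrow> isCont (\<lambda>r. u s) s"
    by (rule isCont_cong)
  then show ?thesis by simp
qed

lemma controls_const: "c \<in> \<Omega> \<Longrightarrow> (\<lambda>s. c) \<in> controls \<Omega>"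
  by (auto simp: controls_def piecewise_constant_def intro: exI[of _ "{}"])

lemma controls_concatenation:
  assumes "u \<in> controls \<Omega>" "v \<in> controls \<Omega>" "e \<in> \<Omega>"
  shows "(\<lambda>s. if s < S then u s else if s = S then e else v (s - S)) \<in> controls \<Omega>"
proof -
  from assms obtain S1 where S1: "\<And>a b. finite (S1 \<inter> {a..b})" 
    "\<And>a b. a \<le> b \<Longrightarrow> {a..b} \<inter> S1 = {} \<Longrightarrow> u a = u b"
    unfolding controls_def piecewise_constant_def mem_Collect_eq by metis
  from assms obtain S2 where S2: "\<And>a b. finite (S2 \<inter> {a..b})" 
    "\<And>a b. a \<le> b \<Longrightarrow> {a..b} \<inter> S2 = {} \<Longrightarrow> v a = v b"
    unfolding controls_def piecewise_constant_def mem_Collect_eq by metis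
  let ?T = "S1 \<union> {S} \<union> (\<lambda>s. s + S) ` S2" and ?w = "\<lambda>s. if s < S then u s else if s = S then e else v (s - S)"
  have "finite (?T \<inter> {a..b})" for a b
  proof -
    have "?T \<inter> {a..b} \<subseteq> S1 \<inter> {a..b} \<union> {S} \<union> (\<lambda>s. s + S) ` (S2 \<inter> {a - S..b - S})"
    proof
      fix x assume "x \<in> ?T \<inter> {a..b}"
      then have x: "x \<in> {a..b}" and "x \<in> S1 \<or> x = S \<or> (\<exists>y\<in>S2. x = y + S)" by blast+
      then consider "x \<in> S1" | "x = S" | y where "y \<in> S2" "x = y + S" by blast
      then show "x \<in> S1 \<inter> {a..b} \<union> {S} \<union> (\<lambda>s. s + S) ` (S2 \<inter> {a - S..b - S})"
      proof cases
        case 3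
        then have "y \<in> S2 \<inter> {a - S..b - S}" using x by auto
        with 3 show ?thesis by blast
      qed (use x in simp_all)
    qed
    moreover have "finite (S1 \<inter> {a..b} \<union> {S} \<union> (\<lambda>s. s + S) ` (S2 \<inter> {a - S..b - S}))"
      using S1(1)[of a b] S2(1)[of "a - S" "b - S"] by (intro finite_UnI finite_imageI) simp_all
    ultimately show ?thesis by (rule finite_subset)
  qed
  moreover have "?w a = ?w b" if ab: "a \<le> b" "{a..b} \<inter> ?T = {}" for a b
  proof -
    have "S \<notin> {a..b}" using ab by blast
    then have "b < S \<or> S < a" by auto
    then show ?thesis
    proof
      assume "b < S"
      moreover have "u a = u b" using ab by (intro S1(2)) auto
      ultimately show ?thesis using ab by simp
    next
      assume "S < a"
      have "x \<notin> S2" if "x \<in> {a - S..b - S}" for x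
      proof
        assume "x \<in> S2"
        then have "x + S \<in> ?T" by blast
        moreover have "x + S \<in> {a..b}" using that by auto
        ultimately show False using ab(2) by blast
      qed
      then have "v (a - S) = v (b - S)" using ab by (intro S2(2)) auto
      then show ?thesis using \<open>S < a\<close> ab by auto
    qed
  qed
  ultimately have "piecewise_constant ?w"
    unfolding piecewise_constant_def by (intro exI[of _ ?T]) blast
  then show ?thesis using assms by (auto simp: controls_def)
qed

lemma pos_orbitI:
  assumes "u \<in> controls \<Omega>" "is_solution f0 f1 u x \<phi>" "S > 0"
  shows "\<phi> S \<in> pos_orbit f0 f1 \<Omega> x"
  unfolding pos_orbit_def mem_Collect_eq
  by (rule exI[of _ \<phi>], rule exI[of _ S], rule exI[of _ u]) (simp add: assms)

text \<open>
  Controls may take any value at a break point.  This freedom is used to make the concatenated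
  control discontinuous at the gluing time \<open>S\<close>, so that no differential equation has to hold there;
  it needs two different control values, since a single one might happen to be the limit at \<open>S\<close>.
\<close>

lemma pos_orbit_trans:
  assumes \<Omega>: "c1 \<in> \<Omega>" "c2 \<in> \<Omega>" "c1 \<noteq> c2"
    and y: "y \<in> pos_orbit f0 f1 \<Omega> x" and z: "z \<in> pos_orbit f0 f1 \<Omega> y"
  shows "z \<in> pos_orbit f0 f1 \<Omega> x"
proof -
  from y obtain \<phi> u S where u: "S > 0" "u \<in> controls \<Omega>" "is_solution f0 f1 u x \<phi>" "y = \<phi> S"
    unfolding pos_orbit_def by blast
  from z obtain \<psi> v T where v: "T > 0" "v \<in> controls \<Omega>" "is_solution f0 f1 v y \<psi>" "z = \<psi> T"
    unfolding pos_orbit_def by blast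
  define w where "w e s = (if s < S then u s else if s = S then e else v (s - S))" for e s
  define \<omega> where "\<omega> s = (if s \<le> S then \<phi> s else \<psi> (s - S))" for s
  obtain e where e: "e \<in> \<Omega>" "\<not> isCont (w e) S"
  proof -
    have "\<not> (isCont (w c1) S \<and> isCont (w c2) S)"
    proof
      assume "isCont (w c1) S \<and> isCont (w c2) S"
      then have "(w c1 \<longlongrightarrow> c1) (at S)" "(w c2 \<longlongrightarrow> c2) (at S)"
        by (auto simp: continuous_at w_def)
      moreover have "(w c1 \<longlongrightarrow> c1) (at S) \<longleftrightarrow> (w c2 \<longlongrightarrow> c1) (at S)"
        by (rule filterlim_cong) (auto simp: w_def eventually_at_filter)
      ultimately show False
        using \<Omega>(3) tendsto_unique[of "at S" "w c2"] by auto
    qed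
    with \<Omega> that show ?thesis by blast
  qed
  have w: "w e \<in> controls \<Omega>"
    unfolding w_def by (rule controls_concatenation[OF u(2) v(2) e(1)])
  have cont: "continuous_on UNIV \<phi>" "continuous_on UNIV \<psi>" and init: "\<phi> 0 = x" "\<psi> 0 = \<phi> S"
    using u v by (auto simp: is_solution_def)
  have "continuous_on ({..S} \<union> {S..}) \<omega>"
    unfolding \<omega>_def
    by (rule continuous_on_cases)
       (auto simp: init intro!: continuous_on_subset[OF cont(1)] continuous_on_compose2[OF cont(2)] continuous_intros)
  moreover have "{..S} \<union> {S..} = UNIV" by auto
  ultimately have cont\<omega>: "continuous_on UNIV \<omega>" by simp
  have der: "(\<omega> has_vector_derivative f0 (\<omega> s) + w e s *\<^sub>R f1 (\<omega> s)) (at s)" if c: "isCont (w e) s" for s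
  proof -
    consider "s < S" | "s > S" using e(2) c by (cases s S rule: linorder_cases) auto
    then show ?thesis
    proof cases
      case 1
      have "eventually (\<lambda>r. w e r = u r) (nhds s)"
        using eventually_nhds_in_open[of "{..<S}" s] 1 by (auto simp: w_def elim: eventually_mono)
      then have "isCont u s" using c by (simp cong: isCont_cong)
      then have d: "(\<phi> has_vector_derivative f0 (\<phi> s) + u s *\<^sub>R f1 (\<phi> s)) (at s)"
        using u by (auto simp: is_solution_def)
      have "(\<omega> has_vector_derivative f0 (\<phi> s) + u s *\<^sub>R f1 (\<phi> s)) (at s)"
        by (rule has_vector_derivative_transform_within_open[OF d, of "{..<S}"]) (use 1 in \<open>auto simp: \<omega>_def\<close>)
      then show ?thesis using 1 by (simp add: \<omega>_def w_def)
    next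
      case 2
      have "eventually (\<lambda>r. w e r = v (r - S)) (nhds s)"
        using eventually_nhds_in_open[of "{S<..}" s] 2 by (auto simp: w_def elim: eventually_mono)
      then have "isCont (\<lambda>r. v (r - S)) s" using c by (simp cong: isCont_cong)
      then have "isCont v (s - S)"
        using continuous_at_compose[of "s - S" "\<lambda>r. r + S" "\<lambda>r. v (r - S)"] by (simp add: o_def)
      then have d': "(\<psi> has_vector_derivative f0 (\<psi> (s - S)) + v (s - S) *\<^sub>R f1 (\<psi> (s - S))) (at (s - S))"
        using v by (auto simp: is_solution_def)
      have d: "((\<lambda>r. \<psi> (r - S)) has_vector_derivative f0 (\<psi> (s - S)) + v (s - S) *\<^sub>R f1 (\<psi> (s - S))) (at s)"
      proof -
        have "((\<lambda>r. r - S) has_vector_derivative 1) (at s)"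
          by (auto intro!: derivative_eq_intros)
        from vector_diff_chain_at[OF this d'] show ?thesis by (simp add: o_def)
      qed
      have "(\<omega> has_vector_derivative f0 (\<psi> (s - S)) + v (s - S) *\<^sub>R f1 (\<psi> (s - S))) (at s)"
        by (rule has_vector_derivative_transform_within_open[OF d, of "{S<..}"]) (use 2 in \<open>auto simp: \<omega>_def\<close>)
      then show ?thesis using 2 by (simp add: \<omega>_def w_def)
    qed
  qed
  have "is_solution f0 f1 (w e) x \<omega>"
    unfolding is_solution_def using cont\<omega> der u(1) by (auto simp: \<omega>_def init)
  from pos_orbitI[OF w this add_pos_pos[OF u(1) v(1)]] show ?thesis
    using v by (simp add: \<omega>_def)
qed

lemma pre_control_set_Union_chain:
  assumes "\<And>D. D \<in> C \<Longrightarrow> pre_control_set f0 f1 \<Omega> D"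
    and "\<And>D E. D \<in> C \<Longrightarrow> E \<in> C \<Longrightarrow> D \<subseteq> E \<or> E \<subseteq> D"
  shows "pre_control_set f0 f1 \<Omega> (\<Union>C)"
  unfolding pre_control_set_def
proof (intro conjI ballI subsetI)
  fix x assume "x \<in> \<Union>C"
  then obtain D where D: "D \<in> C" "x \<in> D" by blast
  then obtain u \<phi> where "u \<in> controls \<Omega>" "is_solution f0 f1 u x \<phi>" "\<phi> ` {0..} \<subseteq> D"
    using assms(1)[OF D(1)] unfolding pre_control_set_def by blast
  with D show "\<exists>u\<in>controls \<Omega>. \<exists>\<phi>. is_solution f0 f1 u x \<phi> \<and> \<phi> ` {0..} \<subseteq> \<Union>C"
    by blast
next
  fix x y assume "x \<in> \<Union>C" "y \<in> \<Union>C"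
  then obtain D where "D \<in> C" "x \<in> D" "y \<in> D" using assms(2) by blast
  then show "y \<in> closure (pos_orbit f0 f1 \<Omega> x)"
    using assms(1) unfolding pre_control_set_def by blast
qed

text \<open>
  Zorn's lemma: both conditions on a pre-control set involve at most two of its points at a time,
  so they survive unions of chains.
\<close>

lemma pre_control_set_extends_to_control_set:
  assumes "pre_control_set f0 f1 \<Omega> D"
  shows "\<exists>E. control_set f0 f1 \<Omega> E \<and> D \<subseteq> E"
proof -
  let ?A = "{E. pre_control_set f0 f1 \<Omega> E \<and> D \<subseteq> E}"
  have "\<exists>M\<in>?A. \<forall>E\<in>?A. M \<subseteq> E \<longrightarrow> E = M"
  proof (rule subset_Zorn_nonempty)
    show "?A \<noteq> {}" using assms by blast
    show "\<Union>C \<in> ?A" if "C \<noteq> {}" "subset.chain ?A C" for C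
    proof -
      have "pre_control_set f0 f1 \<Omega> (\<Union>C)"
        using that unfolding subset.chain_def psubset_eq
        by (intro pre_control_set_Union_chain) blast+
      moreover have "D \<subseteq> \<Union>C"
        using that unfolding subset.chain_def by blast
      ultimately show ?thesis by blast
    qed
  qed
  then obtain M where M: "M \<in> ?A" and max: "\<forall>E\<in>?A. M \<subseteq> E \<longrightarrow> E = M" ..
  have "control_set f0 f1 \<Omega> M"
    unfolding control_set_def
  proof (intro conjI allI impI)
    fix E assume E: "pre_control_set f0 f1 \<Omega> E \<and> M \<subseteq> E"
    with M have "E \<in> ?A" by auto
    with max E show "E = M" by simp
  qed (use M in simp)
  with M show ?thesis by blast
qed

lemma pre_control_set_equilibrium:
  assumes "0 \<in> \<Omega>" "f0 x = 0"
  shows "pre_control_set f0 f1 \<Omega> {x}"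
proof -
  have sol: "is_solution f0 f1 (\<lambda>s. 0) x (\<lambda>s. x)"
    using assms(2) by (auto simp: is_solution_def)
  have u: "(\<lambda>s. 0) \<in> controls \<Omega>" by (rule controls_const[OF assms(1)])
  have "x \<in> pos_orbit f0 f1 \<Omega> x"
    by (rule pos_orbitI[OF u sol zero_less_one])
  then have "x \<in> closure (pos_orbit f0 f1 \<Omega> x)"
    using closure_subset by blast
  with sol u show ?thesis
    unfolding pre_control_set_def by (auto intro!: bexI[of _ "\<lambda>s. 0"] exI[of _ "\<lambda>s. x"])
qed

text \<open>
  If the derivative of \<open>F\<close> along the system is independent of the control, it can be integrated along
  every solution; the finitely many discontinuities of the control are harmless.
\<close>

lemma solution_increment:
  fixes F :: "'a::real_normed_vector \<Rightarrow> real"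
  assumes u: "u \<in> controls \<Omega>" and sol: "is_solution f0 f1 u x \<phi>"
    and F: "continuous_on UNIV F"
    and F': "\<And>p. (F has_derivative F' p) (at p)" "\<And>p c. F' p (f0 p + c *\<^sub>R f1 p) = g p"
    and ab: "a \<le> b"
  shows "((\<lambda>s. g (\<phi> s)) has_integral (F (\<phi> b) - F (\<phi> a))) {a..b}"
proof -
  from u obtain S where S: "\<And>a b. finite (S \<inter> {a..b})" 
    "\<And>a b. a \<le> b \<Longrightarrow> {a..b} \<inter> S = {} \<Longrightarrow> u a = u b"
    unfolding controls_def piecewise_constant_def mem_Collect_eq by metis
  have cont: "continuous_on UNIV \<phi>" using sol by (auto simp: is_solution_def)
  show ?thesis
  proof (rule fundamental_theorem_of_calculus_interior_strong[OF S(1)[of a b] ab, of "\<lambda>s. F (\<phi> s)"])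
    show "continuous_on {a..b} (\<lambda>s. F (\<phi> s))"
      by (rule continuous_on_subset[OF continuous_on_compose2[OF F cont]]) auto
    fix s assume "s \<in> {a<..<b} - S \<inter> {a..b}"
    then have "s \<notin> S" by auto
    with S have "isCont u s" by (rule piecewise_constant_isCont)
    then have d: "(\<phi> has_vector_derivative f0 (\<phi> s) + u s *\<^sub>R f1 (\<phi> s)) (at s)"
      using sol by (auto simp: is_solution_def)
    have "((F \<circ> \<phi>) has_vector_derivative F' (\<phi> s) (f0 (\<phi> s) + u s *\<^sub>R f1 (\<phi> s))) (at s)"
      using vector_derivative_diff_chain_within[of \<phi> _ s UNIV F "F' (\<phi> s)"] d F'(1)
      by (auto intro: has_derivative_at_withinI)
    then show "((\<lambda>s. F (\<phi> s)) has_vector_derivative g (\<phi> s)) (at s)"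
      by (simp add: F'(2) o_def)
  qed
qed

text \<open>
  Any two points of \<open>D\<close> can be approximately reached from each other, so a function that never
  decreases along solutions is constant on \<open>D\<close>.  Through each point there is a solution that stays in
  \<open>D\<close>; the nonnegative continuous rate \<open>g\<close> has integral zero along it, hence vanishes already at
  its initial point.
\<close>

lemma pre_control_set_monotone_function:
  fixes F g :: "'a::real_normed_vector \<Rightarrow> real"
  assumes D: "pre_control_set f0 f1 \<Omega> D"
    and F: "\<And>p. (F has_derivative F' p) (at p)" "\<And>p c. F' p (f0 p + c *\<^sub>R f1 p) = g p"
    and g: "continuous_on UNIV g" "\<And>p. g p \<ge> 0"
  shows "\<And>x y. x \<in> D \<Longrightarrow> y \<in> D \<Longrightarrow> F x = F y"
    and "D \<subseteq> {p. g p = 0}"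
proof -
  have contF: "continuous_on UNIV F"
    by (intro continuous_at_imp_continuous_on ballI has_derivative_continuous[OF F(1)])
  have mono: "F x \<le> F y" if "x \<in> D" "y \<in> D" for x y
  proof -
    have "pos_orbit f0 f1 \<Omega> x \<subseteq> {p. F x \<le> F p}"
    proof
      fix p assume "p \<in> pos_orbit f0 f1 \<Omega> x"
      then obtain \<phi> S u where u: "p = \<phi> S" "S > 0" "u \<in> controls \<Omega>" "is_solution f0 f1 u x \<phi>"
        unfolding pos_orbit_def by blast
      have "((\<lambda>s. g (\<phi> s)) has_integral (F (\<phi> S) - F (\<phi> 0))) {0..S}"
        by (rule solution_increment[OF u(3,4) contF F]) (use u in simp)
      then have "F (\<phi> S) - F (\<phi> 0) \<ge> 0"
        by (rule has_integral_nonneg) (rule g(2))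
      then show "p \<in> {p. F x \<le> F p}" using u by (simp add: is_solution_def)
    qed
    moreover have "closed {p. F x \<le> F p}"
      by (intro closed_Collect_le contF continuous_intros)
    ultimately have "closure (pos_orbit f0 f1 \<Omega> x) \<subseteq> {p. F x \<le> F p}"
      by (rule closure_minimal)
    with D that show ?thesis unfolding pre_control_set_def by blast
  qed
  show eq: "F x = F y" if "x \<in> D" "y \<in> D" for x y
    using mono that by (intro antisym) auto
  show "D \<subseteq> {p. g p = 0}"
  proof
    fix x assume "x \<in> D"
    then obtain u \<phi> where u: "u \<in> controls \<Omega>" "is_solution f0 f1 u x \<phi>" "\<phi> ` {0..} \<subseteq> D"
      using D unfolding pre_control_set_def by blast
    have "F (\<phi> 1) = F (\<phi> 0)"
      using u(3) by (intro eq) auto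
    then have "((\<lambda>s. g (\<phi> s)) has_integral 0) (cbox 0 1)"
      using solution_increment[OF u(1,2) contF F, of 0 1] by simp
    moreover have "continuous_on UNIV \<phi>" using u by (auto simp: is_solution_def)
    then have "continuous_on (cbox 0 1) (\<lambda>s. g (\<phi> s))"
      by (intro continuous_on_compose2[OF g(1)]) (auto intro: continuous_on_subset)
    ultimately have "g (\<phi> 0) = 0"
      by (intro has_integral_0_cbox_imp_0[of 0 1 "\<lambda>s. g (\<phi> s)" 0]) (auto simp: g(2))
    then show "x \<in> {p. g p = 0}" using u by (simp add: is_solution_def)
  qed
qed


section \<open>Control sets with empty interior\<close>

text \<open>
  The monotone function is \<open>l \<bullet> (v - \<Lambda>\<^sub>t \<eta> / \<alpha>)\<close>: the correction removes the contribution of the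
  control to \<open>v'\<close>, and \<open>l \<bullet> \<Lambda>\<^sub>t \<xi>\<close> remains as its rate of growth.
\<close>

lemma infinitely_many_control_sets:
  assumes \<theta>: "\<theta> \<in> structure_matrices" and \<alpha>: "\<alpha> \<noteq> 0" and \<Omega>: "0 \<in> \<Omega>"
    and l: "l \<noteq> 0" "\<And>t. l \<bullet> Lambda \<theta> t \<xi> \<ge> 0" "interior {t. l \<bullet> Lambda \<theta> t \<xi> = 0} = {}"
  shows "infinite {D. control_set (linear_vf \<theta> 0 \<xi>) (left_invariant_vf \<theta> \<alpha> \<eta>) \<Omega> D \<and> interior D = {}}"
    (is "infinite ?C")
proof -
  let ?f0 = "linear_vf \<theta> 0 \<xi>" and ?f1 = "left_invariant_vf \<theta> \<alpha> \<eta>"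
  define F where "F p = l \<bullet> (snd p - (1 / \<alpha>) *\<^sub>R Lambda \<theta> (fst p) \<eta>)" for p :: "real \<times> (real^2)"
  define F' where "F' p q = l \<bullet> (snd q - (1 / \<alpha>) *\<^sub>R (fst q *\<^sub>R (rho \<theta> (fst p) *v \<eta>)))" for p q :: "real \<times> (real^2)"
  have L': "((\<lambda>p. Lambda \<theta> (fst p) \<eta>) has_derivative (\<lambda>q. fst q *\<^sub>R (rho \<theta> (fst p) *v \<eta>))) (at p)"
    for p :: "real \<times> (real^2)"
    using has_derivative_snd[OF field_of_t_derivative[where p = p, OF Lambda_vector_derivative[OF \<theta>]]] by simp
  have F': "(F has_derivative F' p) (at p)" for p
    unfolding F_def[abs_def] F'_def[abs_def] by (intro derivative_intros L')
  have F'_vf: "F' p (?f0 p + c *\<^sub>R ?f1 p) = l \<bullet> Lambda \<theta> (fst p) \<xi>" for p c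
    using \<alpha> by (simp add: F'_def linear_vf_nilrank_zero left_invariant_vf_eq)
  have contL: "continuous_on UNIV (\<lambda>p::real \<times> (real^2). l \<bullet> Lambda \<theta> (fst p) \<xi>)"
    by (intro continuous_intros continuous_on_compose2[OF continuous_on_Lambda[OF \<theta>]]) auto
  note level = pre_control_set_monotone_function[OF _ F' F'_vf contL l(2)]
  \<comment> \<open>An equilibrium on the level set of \<open>F\<close> with value \<open>c\<close>.\<close>
  define x where "x c = (0 :: real, (c / (l \<bullet> l)) *\<^sub>R l)" for c
  have Fx: "F (x c) = c" for c
    using l(1) by (simp add: F_def x_def)
  have "\<exists>D. control_set ?f0 ?f1 \<Omega> D \<and> {x c} \<subseteq> D" for c
    by (intro pre_control_set_extends_to_control_set pre_control_set_equilibrium \<Omega>)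
       (simp add: linear_vf_nilrank_zero x_def zero_prod_def)
  then obtain D where D: "\<And>c. control_set ?f0 ?f1 \<Omega> (D c)" "\<And>c. x c \<in> D c"
    by (metis insert_subset)
  then have pre: "pre_control_set ?f0 ?f1 \<Omega> (D c)" for c
    unfolding control_set_def by blast
  have "interior (D c) = {}" for c
  proof -
    have "D c \<subseteq> {t. l \<bullet> Lambda \<theta> t \<xi> = 0} \<times> UNIV"
      using level(2)[OF pre, of c] by auto
    then have "interior (D c) \<subseteq> interior ({t. l \<bullet> Lambda \<theta> t \<xi> = 0} \<times> UNIV)"
      by (rule interior_mono)
    then show ?thesis by (simp add: interior_Times l(3))
  qed
  then have "range D \<subseteq> ?C" using D by auto
  moreover have "inj D"
  proof (rule injI)
    fix c d assume "D c = D d"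
    then have "F (x c) = F (x d)"
      using D(2)[of c] D(2)[of d] by (intro level(1)[OF pre[of d]]) auto
    then show "c = d" by (simp add: Fx)
  qed
  then have "infinite (range D)"
    by (simp add: finite_image_iff infinite_UNIV_char_0)
  ultimately show ?thesis by (rule infinite_super)
qed

lemma Lambda_inner_derivative:
  assumes "\<theta> \<in> structure_matrices"
  shows "((\<lambda>t. l \<bullet> Lambda \<theta> t \<xi>) has_real_derivative l \<bullet> (rho \<theta> t *v \<xi>)) (at t)"
  unfolding has_real_derivative_iff_has_vector_derivative
  by (rule bounded_linear.has_vector_derivative[OF bounded_linear_inner_right Lambda_vector_derivative[OF assms]])

lemma strict_minimum_at_0:
  fixes f :: "real \<Rightarrow> real"
  assumes f: "\<And>t. (f has_real_derivative f' t) (at t)" "f 0 = 0"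
    and f': "\<And>t. t > 0 \<Longrightarrow> f' t > 0" "\<And>t. t < 0 \<Longrightarrow> f' t < 0"
  shows "f t \<ge> 0" and "f t = 0 \<longleftrightarrow> t = 0"
proof -
  have cont: "continuous_on S f" for S
    by (intro continuous_at_imp_continuous_on ballI DERIV_isCont[OF f(1)])
  have pos: "f t > 0" if "t > 0" for t
    using DERIV_pos_imp_increasing_open[of 0 t f] that f f'(1) cont by auto
  have neg: "f t > 0" if "t < 0" for t
    using DERIV_neg_imp_decreasing_open[of t 0 f] that f f'(2) cont by auto
  show "f t \<ge> 0" "f t = 0 \<longleftrightarrow> t = 0"
    using pos[of t] neg[of t] f(2) by (cases t "0::real" rule: linorder_cases; force)+
qed

text \<open>
  Take \<open>l\<close> orthogonal to \<open>\<xi>\<close>.  Then \<open>l \<bullet> \<Lambda>\<^sub>t \<xi>\<close> has derivative \<open>l \<bullet> \<rho>\<^sub>t \<xi>\<close>, which vanishes at \<open>0\<close>.  In the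
  shear and diagonal cases the direction of \<open>\<rho>\<^sub>t \<xi>\<close> turns monotonically, and by less than a half turn
  away from \<open>\<xi>\<close>, so this derivative has the sign of \<open>t\<close> (after choosing the sign of \<open>l\<close>).  For the
  rotation it is a multiple of \<open>sin t\<close>, and the function is a multiple of \<open>1 - cos t\<close>.  The hypothesis on
  invariant subspaces is tested on eigenlines of \<open>\<theta>\<close> (for the rotation, which has none, on the zero
  subspace), so that \<open>\<xi>\<close> is nonzero and not an eigenvector.
\<close>

lemma exists_nonnegative_functional:
  assumes \<theta>: "\<theta> \<in> structure_matrices" and spiral: "\<And>\<gamma>. \<gamma> \<noteq> 0 \<Longrightarrow> \<theta> \<noteq> spiral_matrix \<gamma>"
    and rank: "\<And>U. subspace U \<Longrightarrow> \<xi> \<in> U \<Longrightarrow> (\<And>u. u \<in> U \<Longrightarrow> \<theta> *v u \<in> U) \<Longrightarrow> U = UNIV"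
  shows "\<exists>l. l \<noteq> 0 \<and> (\<forall>t. l \<bullet> Lambda \<theta> t \<xi> \<ge> 0) \<and> interior {t. l \<bullet> Lambda \<theta> t \<xi> = 0} = {}"
proof -
  obtain a b where \<xi>: "\<xi> = vector [a, b]" by (rule vector_2_exhaust)
  note L' = Lambda_inner_derivative[OF \<theta>]
  have by_sign: ?thesis if "\<And>t. t > 0 \<Longrightarrow> l \<bullet> (rho \<theta> t *v \<xi>) > 0" "\<And>t. t < 0 \<Longrightarrow> l \<bullet> (rho \<theta> t *v \<xi>) < 0" for l
  proof -
    have "l \<noteq> 0" using that(1)[of 1] by auto
    moreover have "l \<bullet> Lambda \<theta> t \<xi> \<ge> 0" "l \<bullet> Lambda \<theta> t \<xi> = 0 \<longleftrightarrow> t = 0" for t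
      using strict_minimum_at_0[OF L', of l \<xi>] that by auto
    ultimately show ?thesis by (intro exI[of _ l]) simp
  qed
  from \<theta> have "\<theta> = mat22 1 1 0 1 \<or> (\<exists>\<gamma>. \<theta> = mat22 1 0 0 \<gamma> \<and> \<bar>\<gamma>\<bar> \<le> 1) \<or> (\<exists>\<gamma>. \<theta> = spiral_matrix \<gamma>)"
    unfolding structure_matrices_def by blast
  with spiral consider "\<theta> = mat22 1 1 0 1" | \<gamma> where "\<theta> = mat22 1 0 0 \<gamma>" "\<bar>\<gamma>\<bar> \<le> 1" | "\<theta> = spiral_matrix 0"
    by metis
  then show ?thesis
  proof cases
    case 1
    have "b \<noteq> 0"
    proof
      assume "b = 0"
      then have "{u :: real^2. u $ 2 = 0} = UNIV"
        by (intro rank) (auto simp: subspace_def \<xi> 1 mat22_mult_vec)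
      then have "(vector [0, 1] :: real^2) \<in> {u. u $ 2 = 0}" by blast
      then show False by simp
    qed
    have k: "vector [b, - a] \<bullet> (rho \<theta> t *v \<xi>) = t * (exp t * b\<^sup>2)" for t
      by (simp add: 1 rho_shear mat22_mult_vec inner_vector_2 \<xi> algebra_simps power2_eq_square)
    show ?thesis
      using \<open>b \<noteq> 0\<close> by (intro by_sign[of "vector [b, - a]"]) (auto simp: k zero_less_mult_iff mult_less_0_iff)
  next
    case 2
    have "a \<noteq> 0"
    proof
      assume "a = 0"
      then have "{u :: real^2. u $ 1 = 0} = UNIV"
        by (intro rank) (auto simp: subspace_def \<xi> 2 mat22_mult_vec)
      then have "(vector [1, 0] :: real^2) \<in> {u. u $ 1 = 0}" by blast
      then show False by simp
    qed
    have "b \<noteq> 0"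
    proof
      assume "b = 0"
      then have "{u :: real^2. u $ 2 = 0} = UNIV"
        by (intro rank) (auto simp: subspace_def \<xi> 2 mat22_mult_vec)
      then have "(vector [0, 1] :: real^2) \<in> {u. u $ 2 = 0}" by blast
      then show False by simp
    qed
    have "\<gamma> \<noteq> 1"
    proof
      assume "\<gamma> = 1"
      then have "{u :: real^2. b * u $ 1 = a * u $ 2} = UNIV"
        by (intro rank) (auto simp: subspace_def \<xi> 2 mat22_mult_vec algebra_simps)
      then have "(vector [1, 0] :: real^2) \<in> {u. b * u $ 1 = a * u $ 2}" by blast
      then show False using \<open>b \<noteq> 0\<close> by simp
    qed
    with 2 have \<gamma>: "\<gamma> < 1" by simp
    \<comment> \<open>The factor \<open>a b\<close> gives \<open>l\<close> the right sign, whichever quadrant \<open>\<xi>\<close> lies in.\<close>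
    have k: "((a * b) *\<^sub>R vector [b, - a]) \<bullet> (rho \<theta> t *v \<xi>) = (a * b)\<^sup>2 * (exp t - exp (\<gamma> * t))" for t
      by (simp add: 2 rho_diagonal mat22_mult_vec inner_vector_2 \<xi> algebra_simps power2_eq_square)
    have "(a * b)\<^sup>2 > 0" using \<open>a \<noteq> 0\<close> \<open>b \<noteq> 0\<close> by simp
    moreover have "t > 0 \<Longrightarrow> \<gamma> * t < t" "t < 0 \<Longrightarrow> t < \<gamma> * t" for t
      using \<gamma> by (simp_all add: mult_less_cancel_right2)
    ultimately show ?thesis
      by (intro by_sign[of "(a * b) *\<^sub>R vector [b, - a]"])
         (unfold k, simp_all add: zero_less_mult_iff mult_less_0_iff)
  next
    case 3
    have "\<xi> \<noteq> 0" by (rule cyclic_vector_nonzero[OF rank])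
    then have ab: "a\<^sup>2 + b\<^sup>2 > 0"
      by (auto simp: \<xi> vec_eq_iff forall_2 sum_power2_gt_zero_iff)
    have k: "vector [- b, a] \<bullet> (rho \<theta> t *v \<xi>) = (a\<^sup>2 + b\<^sup>2) * sin t" for t
      by (simp add: 3 rho_spiral mat22_mult_vec inner_vector_2 \<xi> algebra_simps power2_eq_square)
    have L: "vector [- b, a] \<bullet> Lambda \<theta> t \<xi> = (a\<^sup>2 + b\<^sup>2) * (1 - cos t)" for t
    proof -
      let ?d = "\<lambda>t. vector [- b, a] \<bullet> Lambda \<theta> t \<xi> - (a\<^sup>2 + b\<^sup>2) * (1 - cos t)"
      have "(?d has_real_derivative 0) (at t)" for t
        by (auto intro!: derivative_eq_intros L' simp: k)
      then have "?d t = ?d 0" by (rule DERIV_isconst_all[OF allI])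
      then show ?thesis by simp
    qed
    have "{t::real. cos t = 1} \<subseteq> range (\<lambda>n::int. of_int n * 2 * pi)"
      by (auto simp: cos_one_2pi_int)
    then have "countable {t::real. cos t = 1}"
      by (rule countable_subset) simp
    then have "interior {t::real. cos t = 1} = {}"
      using open_minus_countable[OF _ _ open_interior] interior_subset by blast
    moreover have "{t. vector [- b, a] \<bullet> Lambda \<theta> t \<xi> = 0} = {t. cos t = 1}"
      using ab by (auto simp: L)
    moreover have "vector [- b, a] \<noteq> (0 :: real^2)"
      using ab by (auto simp: vec_eq_iff forall_2)
    ultimately show ?thesis
      using ab by (intro exI[of _ "vector [- b, a]"]) (simp add: L)
  qed
qed


section \<open>Controllability for spirals\<close>

lemma wait_at_t:
  assumes "0 \<in> \<Omega>" "\<tau> > 0"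
  shows "(t, v + \<tau> *\<^sub>R Lambda \<theta> t \<xi>) \<in> pos_orbit (linear_vf \<theta> 0 \<xi>) (left_invariant_vf \<theta> \<alpha> \<eta>) \<Omega> (t, v)"
proof -
  let ?\<phi> = "\<lambda>s. (t, v + s *\<^sub>R Lambda \<theta> t \<xi>)"
  have "(?\<phi> has_vector_derivative (0, Lambda \<theta> t \<xi>)) (at s)" for s
    by (auto intro!: derivative_eq_intros)
  then have "is_solution (linear_vf \<theta> 0 \<xi>) (left_invariant_vf \<theta> \<alpha> \<eta>) (\<lambda>s. 0) (t, v) ?\<phi>"
    by (auto simp: is_solution_def linear_vf_nilrank_zero intro!: continuous_intros)
  from pos_orbitI[OF controls_const[OF assms(1)] this assms(2)] show ?thesis by simp
qed

text \<open>
  The fields do not depend on \<open>v\<close>, so the displacement \<open>d\<close> produced by a constant control that takes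
  \<open>t\<close> to \<open>t'\<close> is the same for all starting values of \<open>v\<close>.
\<close>

lemma move_in_t:
  assumes \<theta>: "\<theta> \<in> structure_matrices" and "\<alpha> \<noteq> 0" "u1 \<in> \<Omega>" "u1 < 0" "u2 \<in> \<Omega>" "u2 > 0" "0 \<in> \<Omega>"
  shows "\<exists>d. \<forall>v. (t', v + d) \<in> pos_orbit (linear_vf \<theta> 0 \<xi>) (left_invariant_vf \<theta> \<alpha> \<eta>) \<Omega> (t, v)"
proof -
  have "\<exists>c\<in>\<Omega>. \<exists>S>0. t' = t + S * (c * \<alpha>)"
  proof (cases "t' = t")
    case True
    then show ?thesis using assms(7) by (intro bexI[of _ 0] exI[of _ 1]) auto
  next
    case False
    obtain c where c: "c \<in> \<Omega>" "(t' - t) / (c * \<alpha>) > 0"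
    proof (cases "(t' - t) / \<alpha> > 0")
      case True
      have "(t' - t) / (u2 * \<alpha>) > 0"
        using divide_pos_pos[OF True assms(6)] by (simp add: mult.commute)
      with assms that show ?thesis by blast
    next
      assume "\<not> (t' - t) / \<alpha> > 0"
      moreover have "(t' - t) / \<alpha> \<noteq> 0" using False assms(2) by simp
      ultimately have "(t' - t) / \<alpha> < 0" by linarith
      then have "(t' - t) / (u1 * \<alpha>) > 0"
        using divide_neg_neg[of "(t' - t) / \<alpha>" u1] assms(4) by (simp add: mult.commute)
      with assms that show ?thesis by blast
    qed
    then have "c \<noteq> 0" by auto
    with c assms(2) show ?thesis
      by (intro bexI[of _ c] exI[of _ "(t' - t) / (c * \<alpha>)"] conjI) simp_all
  qed
  then obtain c S where c: "c \<in> \<Omega>" "S > 0" "t' = t + S * (c * \<alpha>)" by blast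
  define h where "h s = Lambda \<theta> (t + s * (c * \<alpha>)) \<xi> + c *\<^sub>R (rho \<theta> (t + s * (c * \<alpha>)) *v \<eta>)" for s
  define H where "H s = (LBINT r=ereal 0..ereal s. h r)" for s
  have rho: "continuous_on UNIV (\<lambda>t. rho \<theta> t *v \<eta>)"
    by (intro continuous_at_imp_continuous_on ballI has_vector_derivative_continuous[OF rho_vec_derivative[OF \<theta>]])
  have "continuous_on UNIV h"
    unfolding h_def
    by (intro continuous_intros continuous_on_compose2[OF continuous_on_Lambda[OF \<theta>]]
          continuous_on_compose2[OF rho]) auto
  then have H: "(H has_vector_derivative h s) (at s)" for s
    unfolding H_def by (rule interval_integral_vector_derivative)
  have H0: "H 0 = 0"
    by (simp add: H_def interval_lebesgue_integral_def set_lebesgue_integral_def)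
  have "(t', v + H S) \<in> pos_orbit (linear_vf \<theta> 0 \<xi>) (left_invariant_vf \<theta> \<alpha> \<eta>) \<Omega> (t, v)" for v
  proof -
    let ?\<phi> = "\<lambda>s. (t + s * (c * \<alpha>), v + H s)"
    have d: "(?\<phi> has_vector_derivative (c * \<alpha>, h s)) (at s)" for s
      by (intro has_vector_derivative_Pair) (auto intro!: derivative_eq_intros H)
    have "continuous_on UNIV ?\<phi>"
      by (intro continuous_at_imp_continuous_on ballI has_vector_derivative_continuous[OF d])
    then have "is_solution (linear_vf \<theta> 0 \<xi>) (left_invariant_vf \<theta> \<alpha> \<eta>) (\<lambda>s. c) (t, v) ?\<phi>"
      using d by (simp add: is_solution_def linear_vf_nilrank_zero left_invariant_vf_eq H0 h_def)
    from pos_orbitI[OF controls_const[OF c(1)] this c(2)] show ?thesis by (simp add: c(3))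
  qed
  then show ?thesis by blast
qed

text \<open>
  The vectors \<open>(R - 1, 0)\<close>, \<open>(-1, p)\<close>, \<open>(-1, -q)\<close> span the plane with positive coefficients.  Making
  both \<open>y\<close> and \<open>z\<close> large, balanced so that \<open>y p - z q = b\<close>, pushes the first coordinate as far to the
  left as needed for \<open>x\<close> to be positive.
\<close>

lemma positive_span:
  fixes R p q :: real
  assumes "R > 1" "p > 0" "q > 0"
  shows "\<exists>x y z. x > 0 \<and> y > 0 \<and> z > 0 \<and> x * (R - 1) - y - z = a \<and> y * p - z * q = b"
proof -
  \<comment> \<open>Large enough for \<open>b + K > 0\<close> and for \<open>a + y > 0\<close>.\<close>
  define K where "K = max 0 (- b) + max 0 (- a * p) + 1"
  define y z where "y = (b + K) / p" and "z = K / q"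
  have K: "K > 0" "b + K > 0" unfolding K_def by auto
  have yz: "y > 0" "z > 0" using K assms by (auto simp: y_def z_def)
  have "a * p + (b + K) > 0" unfolding K_def by (auto simp: max_def)
  then have "a + y > 0" using assms by (simp add: y_def field_simps)
  then have "a + y + z > 0" using yz by simp
  then have "(a + y + z) / (R - 1) > 0" using assms by simp
  moreover have "(a + y + z) / (R - 1) * (R - 1) - y - z = a" using assms by simp
  moreover have "y * p - z * q = b" using assms by (simp add: y_def z_def)
  ultimately show ?thesis using yz by blast
qed

text \<open>
  With \<open>\<theta> \<zeta> = \<xi>\<close> one has \<open>\<Lambda>\<^sub>t \<xi> = \<rho>\<^sub>t \<zeta> - \<zeta>\<close>, as both sides vanish at \<open>0\<close> and have the same derivative.  In
  the orthogonal basis of \<open>\<zeta>\<close> and its quarter turn, a full turn in the expanding direction of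
  the spiral gives \<open>(R - 1, 0)\<close> with \<open>R > 1\<close>, and quarter turns to either side give \<open>(-1, p)\<close> and
  \<open>(-1, -q)\<close>.
\<close>

lemma spiral_Lambda_positive_span:
  assumes "\<gamma> \<noteq> 0" "\<xi> \<noteq> 0"
  shows "\<exists>T1 T2 T3. \<forall>w. \<exists>\<tau>1 \<tau>2 \<tau>3. \<tau>1 > 0 \<and> \<tau>2 > 0 \<and> \<tau>3 > 0 \<and>
    w = \<tau>1 *\<^sub>R Lambda (spiral_matrix \<gamma>) T1 \<xi> + \<tau>2 *\<^sub>R Lambda (spiral_matrix \<gamma>) T2 \<xi>
      + \<tau>3 *\<^sub>R Lambda (spiral_matrix \<gamma>) T3 \<xi>"
proof -
  let ?\<theta> = "spiral_matrix \<gamma>"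
  have \<theta>: "?\<theta> \<in> structure_matrices" by (simp add: structure_matrices_def)
  obtain a b where \<xi>: "\<xi> = vector [a, b]" by (rule vector_2_exhaust)
  \<comment> \<open>Inverse of the complex number \<open>\<gamma> + \<i>\<close>, applied to \<open>\<xi>\<close>.\<close>
  define i where "i = 1 / (\<gamma>\<^sup>2 + 1)"
  define \<zeta> where "\<zeta> = (vector [i * (\<gamma> * a + b), i * (\<gamma> * b - a)] :: real^2)"
  have "\<gamma>\<^sup>2 + 1 > 0" by (simp add: add_nonneg_pos)
  then have i: "i * (\<gamma> * \<gamma> + 1) = 1" by (simp add: i_def power2_eq_square)
  have "\<gamma> * (i * (\<gamma> * a + b)) - i * (\<gamma> * b - a) = a" "i * (\<gamma> * a + b) + \<gamma> * (i * (\<gamma> * b - a)) = b"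
    using i by algebra+
  then have \<zeta>: "?\<theta> *v \<zeta> = \<xi>"
    unfolding \<zeta>_def \<xi> spiral_matrix_def mat22_mult_vec by simp
  have L: "Lambda ?\<theta> t \<xi> = rho ?\<theta> t *v \<zeta> - \<zeta>" for t
  proof -
    let ?d = "\<lambda>t. Lambda ?\<theta> t \<xi> - rho ?\<theta> t *v \<zeta>"
    have "(?d has_vector_derivative 0) (at t within UNIV)" for t
      using has_vector_derivative_diff[OF Lambda_vector_derivative[OF \<theta>, of \<xi> t] rho_vec_derivative[OF \<theta>, of \<zeta> t]]
      by (simp add: \<zeta>)
    then obtain c where c: "\<And>t. ?d t = c"
      using has_vector_derivative_zero_constant[of UNIV ?d] by auto
    have "?d t = ?d 0" by (simp only: c)
    then show ?thesis by (simp add: rho_0[OF \<theta>] algebra_simps)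
  qed
  obtain x y where xy: "\<zeta> = vector [x, y]" by (rule vector_2_exhaust)
  have "\<zeta> \<noteq> 0" using \<zeta> assms(2) by auto
  then have n: "x\<^sup>2 + y\<^sup>2 > 0"
    by (auto simp: xy vec_eq_iff forall_2 sum_power2_gt_zero_iff)
  let ?T = "2 * pi * sgn \<gamma>"
  have T: "cos ?T = 1" "sin ?T = 0" using assms by (auto simp: sgn_if)
  have "\<gamma> * ?T > 0" using assms by (auto simp: sgn_if zero_less_mult_iff)
  then have R: "exp (\<gamma> * ?T) > 1" by simp
  let ?p = "exp (\<gamma> * (pi / 2))" and ?q = "exp (\<gamma> * (- pi / 2))"
  have "\<exists>\<tau>1 \<tau>2 \<tau>3. \<tau>1 > 0 \<and> \<tau>2 > 0 \<and> \<tau>3 > 0 \<and>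
    w = \<tau>1 *\<^sub>R Lambda ?\<theta> ?T \<xi> + \<tau>2 *\<^sub>R Lambda ?\<theta> (pi / 2) \<xi> + \<tau>3 *\<^sub>R Lambda ?\<theta> (- pi / 2) \<xi>" for w
  proof -
    obtain w1 w2 where w: "w = vector [w1, w2]" by (rule vector_2_exhaust)
    \<comment> \<open>Coordinates of \<open>w\<close> in the basis of \<open>\<zeta>\<close> and its quarter turn.\<close>
    define A B where "A = (w1 * x + w2 * y) / (x\<^sup>2 + y\<^sup>2)" and "B = (w2 * x - w1 * y) / (x\<^sup>2 + y\<^sup>2)"
    have AB: "w1 = A * x - B * y" "w2 = A * y + B * x"
      using n unfolding A_def B_def by (auto simp: divide_simps) (auto simp: algebra_simps power2_eq_square)
    obtain \<tau>1 \<tau>2 \<tau>3 where \<tau>: "\<tau>1 > 0" "\<tau>2 > 0" "\<tau>3 > 0"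
      and A: "A = \<tau>1 * (exp (\<gamma> * ?T) - 1) - \<tau>2 - \<tau>3" and B: "B = \<tau>2 * ?p - \<tau>3 * ?q"
      using positive_span[OF R, of ?p ?q A B] by force
    have "w = \<tau>1 *\<^sub>R Lambda ?\<theta> ?T \<xi> + \<tau>2 *\<^sub>R Lambda ?\<theta> (pi / 2) \<xi> + \<tau>3 *\<^sub>R Lambda ?\<theta> (- pi / 2) \<xi>"
      unfolding L rho_spiral T xy w AB A B mat22_mult_vec
      by (simp add: vec_eq_iff forall_2 algebra_simps)
    with \<tau> show ?thesis by blast
  qed
  then show ?thesis by blast
qed

lemma spiral_controllable:
  assumes \<gamma>: "\<gamma> \<noteq> 0" and \<xi>: "\<xi> \<noteq> 0" and \<alpha>: "\<alpha> \<noteq> 0"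
    and \<Omega>: "u1 \<in> \<Omega>" "u1 < 0" "u2 \<in> \<Omega>" "u2 > 0" "0 \<in> \<Omega>"
  shows "controllable (linear_vf (spiral_matrix \<gamma>) 0 \<xi>) (left_invariant_vf (spiral_matrix \<gamma>) \<alpha> \<eta>) \<Omega>"
proof -
  let ?\<theta> = "spiral_matrix \<gamma>"
  let ?f0 = "linear_vf ?\<theta> 0 \<xi>" and ?f1 = "left_invariant_vf ?\<theta> \<alpha> \<eta>"
  have \<theta>: "?\<theta> \<in> structure_matrices" by (simp add: structure_matrices_def)
  have trans: "z \<in> pos_orbit ?f0 ?f1 \<Omega> x" if "y \<in> pos_orbit ?f0 ?f1 \<Omega> x" "z \<in> pos_orbit ?f0 ?f1 \<Omega> y" for x y z
    using pos_orbit_trans[OF \<Omega>(1,3) _ that] \<Omega> by auto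
  have reach: "y \<in> pos_orbit ?f0 ?f1 \<Omega> x" for x y
  proof -
    obtain t v where x: "x = (t, v)" by (cases x)
    obtain t' v' where y: "y = (t', v')" by (cases y)
    obtain T1 T2 T3 where T: "\<And>w. \<exists>\<tau>1 \<tau>2 \<tau>3. \<tau>1 > 0 \<and> \<tau>2 > 0 \<and> \<tau>3 > 0 \<and>
      w = \<tau>1 *\<^sub>R Lambda ?\<theta> T1 \<xi> + \<tau>2 *\<^sub>R Lambda ?\<theta> T2 \<xi> + \<tau>3 *\<^sub>R Lambda ?\<theta> T3 \<xi>"
      using spiral_Lambda_positive_span[OF \<gamma> \<xi>] by blast
    note move = move_in_t[OF \<theta> \<alpha> \<Omega>]
    obtain d1 where d1: "\<And>v. (T1, v + d1) \<in> pos_orbit ?f0 ?f1 \<Omega> (t, v)" using move by blast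
    obtain d2 where d2: "\<And>v. (T2, v + d2) \<in> pos_orbit ?f0 ?f1 \<Omega> (T1, v)" using move by blast
    obtain d3 where d3: "\<And>v. (T3, v + d3) \<in> pos_orbit ?f0 ?f1 \<Omega> (T2, v)" using move by blast
    obtain d4 where d4: "\<And>v. (t', v + d4) \<in> pos_orbit ?f0 ?f1 \<Omega> (T3, v)" using move by blast
    obtain \<tau>1 \<tau>2 \<tau>3 where \<tau>: "\<tau>1 > 0" "\<tau>2 > 0" "\<tau>3 > 0" and
      w: "v' - v - d1 - d2 - d3 - d4 = \<tau>1 *\<^sub>R Lambda ?\<theta> T1 \<xi> + \<tau>2 *\<^sub>R Lambda ?\<theta> T2 \<xi> + \<tau>3 *\<^sub>R Lambda ?\<theta> T3 \<xi>"
      using T by blast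
    note wait = wait_at_t[OF \<Omega>(5)]
    note path = trans[OF trans[OF trans[OF trans[OF trans[OF trans[OF
      d1 wait[OF \<tau>(1)]] d2] wait[OF \<tau>(2)]] d3] wait[OF \<tau>(3)]] d4]
    have "v' = v + d1 + \<tau>1 *\<^sub>R Lambda ?\<theta> T1 \<xi> + d2 + \<tau>2 *\<^sub>R Lambda ?\<theta> T2 \<xi> + d3 + \<tau>3 *\<^sub>R Lambda ?\<theta> T3 \<xi> + d4"
      using w by (simp add: algebra_simps)
    then show ?thesis unfolding x y using path[of v] by simp
  qed
  have "\<exists>u\<in>controls \<Omega>. \<exists>\<phi>. is_solution ?f0 ?f1 u x \<phi> \<and> \<phi> ` {0..} \<subseteq> UNIV" for x
    using reach[of x x] unfolding pos_orbit_def by blast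
  moreover have "pos_orbit ?f0 ?f1 \<Omega> x = UNIV" for x
    using reach by blast
  ultimately show ?thesis
    unfolding controllable_def control_set_def pre_control_set_def by auto
qed

theorem theorem4p4:
  fixes \<theta> A :: "real^2^2" and \<xi> \<eta> :: "real^2" and \<alpha> umin umax :: real
  assumes "\<theta> \<in> structure_matrices"
    and "umin < 0" and "0 < umax"
    and "A ** \<theta> = \<theta> ** A"
    and "rank A = 0"
    and "LARC (linear_vf \<theta> A \<xi>) (left_invariant_vf \<theta> \<alpha> \<eta>)"
  shows "((\<forall>\<gamma>. \<gamma> \<noteq> 0 \<longrightarrow> \<theta> \<noteq> spiral_matrix \<gamma>) \<longrightarrow>
            infinite {D. control_set (linear_vf \<theta> A \<xi>) (left_invariant_vf \<theta> \<alpha> \<eta>) {umin..umax} D \<and>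
                         interior D = {}}) \<and>
         ((\<exists>\<gamma>. \<gamma> \<noteq> 0 \<and> \<theta> = spiral_matrix \<gamma>) \<longrightarrow>
            controllable (linear_vf \<theta> A \<xi>) (left_invariant_vf \<theta> \<alpha> \<eta>) {umin..umax})"
proof -
  have A: "A = 0" using assms(5) by (simp add: rank_eq_0)
  note larc = LARC_imp_alpha_nonzero[OF assms(1) assms(6)[unfolded A]]
    LARC_imp_cyclic[OF assms(1) assms(6)[unfolded A]]
  show ?thesis
    unfolding A
  proof (intro conjI impI)
    assume "\<forall>\<gamma>. \<gamma> \<noteq> 0 \<longrightarrow> \<theta> \<noteq> spiral_matrix \<gamma>"
    then have "\<exists>l. l \<noteq> 0 \<and> (\<forall>t. l \<bullet> Lambda \<theta> t \<xi> \<ge> 0) \<and> interior {t. l \<bullet> Lambda \<theta> t \<xi> = 0} = {}"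
      by (intro exists_nonnegative_functional assms(1) larc(2)) auto
    then show "infinite {D. control_set (linear_vf \<theta> 0 \<xi>) (left_invariant_vf \<theta> \<alpha> \<eta>) {umin..umax} D \<and>
        interior D = {}}"
      using assms(2,3) by (elim exE conjE) (intro infinitely_many_control_sets[OF assms(1) larc(1)]; simp)
  next
    assume "\<exists>\<gamma>. \<gamma> \<noteq> 0 \<and> \<theta> = spiral_matrix \<gamma>"
    then obtain \<gamma> where \<gamma>: "\<gamma> \<noteq> 0" "\<theta> = spiral_matrix \<gamma>" by blast
    have "\<xi> \<noteq> 0"
      by (rule cyclic_vector_nonzero[OF larc(2)])
    then show "controllable (linear_vf \<theta> 0 \<xi>) (left_invariant_vf \<theta> \<alpha> \<eta>) {umin..umax}"
      unfolding \<gamma>(2) using assms(2,3) \<gamma>(1) larc(1)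
      by (intro spiral_controllable[where ?u1.0 = umin and ?u2.0 = umax]) auto
  qed
qed

end
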